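(* Let $p$ be an odd prime, $k_1,\dots,k_m$ natural numbers, and $k,r$ natural numbers with $2r\le m$ and $k\le\min_{1\le i\le 2r}k_i$. Then $$\Delta\Big[\prod_{i=1}^mC_{p^{k_i}}\Big]\le \Delta\Big[\prod_{i=1}^{2r}C_{p^{k_i-k}}\times\prod_{i=2r+1}^mC_{p^{k_i}}\Big]\cdot p^{kr}+\Delta\Big[\prod_{i=1}^rC_{p^{k_i-1}}\times\prod_{i=r+1}^mC_{p^{k_i}}\Big]-1$$ and $$\eth\Big[\prod_{i=1}^mC_{p^{k_i}}\Big]\le \eth\Big[\prod_{i=1}^{2r}C_{p^{k_i-k}}\times\prod_{i=2r+1}^mC_{p^{k_i}}\Big]+\frac{1}{\sqrt{p^r}}\cdot\eth\Big[\prod_{i=1}^rC_{p^{k_i-1}}\times\prod_{i=r+1}^mC_{p^{k_i}}\Big]-\prod_{i=1}^m\frac{1}{\sqrt{p^{k_i}}}.$$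
   Context: For a subset $A$ of a group $G$, a subset $B\subseteq G$ is a difference basis for $A$ if every $a\in A$ can be written as $a=xy^{-1}$ with $x,y\in B$. The difference size $\Delta[A]$ is the smallest cardinality of a difference basis for $A$, and $\eth[A]=\Delta[A]/\sqrt{|A|}$. $C_n$ is the cyclic group of order $n$; $C_1=C_{p^0}$ is trivial. *)

theory Defs
  imports
    Complex_Main
    "HOL-Algebra.Elementary_Groups"
    "HOL-Algebra.Product_Groups"
    "HOL-Computational_Algebra.Primes"
begin

definition difference_basis :: "('a, 'b) monoid_scheme \<Rightarrow> 'a set \<Rightarrow> 'a set \<Rightarrow> bool" where
  "difference_basis G A B \<longleftrightarrow>
     B \<subseteq> carrier G \<and> (\<forall>a\<in>A. \<exists>x\<in>B. \<exists>y\<in>B. a = x \<otimes>\<^bsub>G\<^esub> inv\<^bsub>G\<^esub> y)"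

(* Meaningful only for sets that have a finite difference basis, i.e. for finite A.
   The condition "finite B" is needed because card is 0 on infinite sets. *)
definition difference_size :: "('a, 'b) monoid_scheme \<Rightarrow> 'a set \<Rightarrow> nat" where
  "difference_size G A = (LEAST n. \<exists>B. difference_basis G A B \<and> finite B \<and> card B = n)"

definition difference_characteristic :: "('a, 'b) monoid_scheme \<Rightarrow> 'a set \<Rightarrow> real" where
  "difference_characteristic G A = real (difference_size G A) / sqrt (real (card A))"

(* The numbers Delta[G] and eth[G] of a whole group. *)
abbreviation group_difference_size :: "('a, 'b) monoid_scheme \<Rightarrow> nat" where
  "group_difference_size G \<equiv> difference_size G (carrier G)"

abbreviation group_difference_characteristic :: "('a, 'b) monoid_scheme \<Rightarrow> real" where
  "group_difference_characteristic G \<equiv> difference_characteristic G (carrier G)"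

end

theory Submission
  imports "HOL-Algebra.Algebraic_Closure" "HOL-Number_Theory.Residues" Defs
begin

text \<open>
  Let \<open>F\<close> be the field with \<open>p ^ r\<close> elements. In coordinates, its multiplication is a symmetric
  bilinear map on \<open>r\<close>-dimensional vectors without zero divisors modulo \<open>p\<close>. Its structure constants are
  lifted to integers and define the map \<open>f x = x * x\<close> modulo \<open>p ^ k\<close>; associativity is not needed. If \<open>d\<close>
  does not vanish modulo \<open>p\<close>, then \<open>x \<mapsto> f (x + d) - f x = 2 * x * d + d * d\<close> is injective, hence
  bijective, modulo \<open>p ^ k\<close>. So the differences of points on the parabola \<open>{(x, f x)}\<close>, which has
  \<open>p ^ (k * r)\<close> points, cover all \<open>(d, e)\<close> with \<open>d\<close> nonzero modulo \<open>p\<close>.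

  Lift the parabola to the first \<open>2 * r\<close> coordinates of the big group and multiply it by a difference basis
  of the subgroup \<open>H\<close> of elements whose first \<open>2 * r\<close> coordinates are divisible by \<open>p ^ k\<close>. This yields
  all elements outside the subgroup \<open>K\<close> of elements whose first \<open>r\<close> coordinates are divisible by \<open>p\<close>.
  For \<open>K\<close> one adds a difference basis of \<open>K\<close>, translated so as to share a point with the first set.
\<close>

subsection \<open>The field with \<open>p ^ r\<close> elements\<close>

lemma (in cring) binomial_finsum:
  assumes x: "x \<in> carrier R" and y: "y \<in> carrier R"
  shows "(x \<oplus> y) [^] (n::nat) = (\<Oplus>k\<in>{..n}. [(n choose k)] \<cdot> (x [^] k \<otimes> y [^] (n - k)))"
proof (induction n)
  case 0
  then show ?case by simp
next
  case (Suc n)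
  let ?S = "\<Oplus>k\<in>{..n}. [(n choose k)] \<cdot> (x [^] k \<otimes> y [^] (n - k))"
  let ?U = "\<lambda>k. [(n choose k)] \<cdot> (x [^] Suc k \<otimes> y [^] (n - k))"
  let ?V = "\<lambda>k. [(n choose k)] \<cdot> (x [^] k \<otimes> y [^] (Suc n - k))"
  let ?T = "\<lambda>k. [(Suc n choose k)] \<cdot> (x [^] k \<otimes> y [^] (Suc n - k))"
  have U: "?S \<otimes> x = (\<Oplus>k\<in>{..n}. ?U k)"
    using x y by (subst finsum_ldistr) (auto intro!: finsum_cong' simp: add_pow_ldistr add_pow_rdistr m_ac)
  have "?S \<otimes> y = (\<Oplus>k\<in>{..n}. ?V k)"
    using x y by (subst finsum_ldistr)
      (auto intro!: finsum_cong' simp: add_pow_ldistr m_assoc Suc_diff_le)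
  \<comment> \<open>The added term vanishes because \<open>n choose Suc n = 0\<close>; it makes room
    for the index shift that follows.\<close>
  also have "\<dots> = (\<Oplus>k\<in>{..Suc n}. ?V k)"
    using x y by (subst finsum_Suc) (simp_all add: binomial_eq_0 Pi_def)
  also have "\<dots> = (\<Oplus>k\<in>{..n}. ?V (Suc k)) \<oplus> ?V 0"
    using x y by (subst finsum_Suc2) auto
  finally have V: "?S \<otimes> y = (\<Oplus>k\<in>{..n}. ?V (Suc k)) \<oplus> ?V 0" .
  have "(x \<oplus> y) [^] Suc n = ?S \<otimes> x \<oplus> ?S \<otimes> y"
    using x y Suc.IH by (simp add: r_distr)
  also have "\<dots> = ((\<Oplus>k\<in>{..n}. ?U k) \<oplus> (\<Oplus>k\<in>{..n}. ?V (Suc k))) \<oplus> ?V 0"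
    unfolding U V using x y by (intro a_assoc [symmetric] finsum_closed) auto
  also have "(\<Oplus>k\<in>{..n}. ?U k) \<oplus> (\<Oplus>k\<in>{..n}. ?V (Suc k)) = (\<Oplus>k\<in>{..n}. ?U k \<oplus> ?V (Suc k))"
    using x y by (intro finsum_addf [symmetric]) auto
  \<comment> \<open>Pascal's rule adds the two coefficients of
    \<open>x [^] Suc k \<otimes> y [^] (n - k)\<close>.\<close>
  also have "\<dots> = (\<Oplus>k\<in>{..n}. ?T (Suc k))"
    using x y by (intro finsum_cong') (auto simp: add.nat_pow_mult)
  also have "\<dots> \<oplus> ?V 0 = (\<Oplus>k\<in>{..Suc n}. ?T k)"
    using x y by (subst finsum_Suc2) auto
  finally show ?case .
qed

lemma (in ring) add_pow_eq_zero_of_dvd: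
  assumes "[p] \<cdot> \<one> = \<zero>" and "(p::nat) dvd n" and x: "x \<in> carrier R"
  shows "[n] \<cdot> x = \<zero>"
proof -
  obtain m where n: "n = p * m" using assms by blast
  have "[n] \<cdot> x = [m] \<cdot> ([p] \<cdot> (\<one> \<otimes> x))"
    using x by (simp add: n add.nat_pow_pow)
  also have "[p] \<cdot> (\<one> \<otimes> x) = ([p] \<cdot> \<one>) \<otimes> x"
    using x by (intro add_pow_ldistr [symmetric]) simp_all
  also have "\<dots> = \<zero>"
    unfolding assms(1) using x by simp
  finally show ?thesis by simp
qed

text \<open>The inner binomial coefficients \<open>p choose k\<close> are divisible by
  \<open>p\<close>, which gives additivity for the exponent \<open>p\<close>; iteration gives the
  exponent \<open>p ^ r\<close>.\<close>

lemma (in cring) frobenius_add: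
  assumes p: "prime (p::nat)" and char: "[p] \<cdot> \<one> = \<zero>"
    and x: "x \<in> carrier R" and y: "y \<in> carrier R"
  shows "(x \<oplus> y) [^] (p ^ r :: nat) = x [^] (p ^ r) \<oplus> y [^] (p ^ r)"
proof (induction r)
  case 0
  then show ?case using x y by simp
next
  case (Suc r)
  have frob: "(a \<oplus> b) [^] p = a [^] p \<oplus> b [^] p" if a: "a \<in> carrier R" and b: "b \<in> carrier R" for a b
  proof -
    let ?f = "\<lambda>k. [(p choose k)] \<cdot> (a [^] k \<otimes> b [^] (p - k))"
    \<comment> \<open>With \<open>p = n + 2\<close> the first and the last term of the binomial sum
      split off, leaving exactly the indices from 1 to \<open>p - 1\<close>.\<close>
    obtain n where n: "p = Suc (Suc n)"
      using prime_ge_2_nat [OF p] by (metis Suc_le_D numeral_2_eq_2 Suc_le_mono)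
    have zero: "?f k = \<zero>" if "0 < k" "k < p" for k
      using that a b by (intro add_pow_eq_zero_of_dvd [OF char] dvd_choose_prime p) simp_all
    have "(\<Oplus>k\<in>{..Suc n}. ?f k) = (\<Oplus>k\<in>{..n}. ?f (Suc k)) \<oplus> ?f 0"
      using a b by (intro finsum_Suc2) auto
    also have "(\<Oplus>k\<in>{..n}. ?f (Suc k)) = (\<Oplus>k\<in>{..n}. \<zero>)"
      by (intro finsum_cong' zero) (auto simp: n)
    finally have "(\<Oplus>k\<in>{..Suc n}. ?f k) = ?f 0" using a b by simp
    moreover have "(\<Oplus>k\<in>{..Suc (Suc n)}. ?f k) = ?f (Suc (Suc n)) \<oplus> (\<Oplus>k\<in>{..Suc n}. ?f k)"
      using a b by (intro finsum_Suc) auto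
    moreover have "(a \<oplus> b) [^] p = (\<Oplus>k\<in>{..Suc (Suc n)}. ?f k)"
      unfolding binomial_finsum [OF a b, of p] by (simp only: n)
    ultimately show ?thesis using a b by (simp add: n [symmetric] del: nat_pow_Suc)
  qed
  have "(x \<oplus> y) [^] (p ^ Suc r) = ((x \<oplus> y) [^] (p ^ r)) [^] p"
    using x y by (simp add: nat_pow_pow mult.commute)
  also have "\<dots> = x [^] (p ^ Suc r) \<oplus> y [^] (p ^ Suc r)"
    using x y by (simp add: Suc.IH frob nat_pow_pow mult.commute)
  finally show ?case .
qed

section \<open>The roots of \<open>X ^ (p ^ r) - X\<close>\<close>

lemma (in domain) univ_poly_char:
  assumes "[p] \<cdot> \<one> = \<zero>"
  shows "[(p::nat)] \<cdot>\<^bsub>poly_ring R\<^esub> \<one>\<^bsub>poly_ring R\<^esub> = \<zero>\<^bsub>poly_ring R\<^esub>"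
proof -
  interpret C: ring_hom_ring R "poly_ring R" poly_of_const
    using canonical_embedding_ring_hom [OF carrier_is_subring] by simp
  have "[n] \<cdot>\<^bsub>poly_ring R\<^esub> \<one>\<^bsub>poly_ring R\<^esub> = poly_of_const ([n] \<cdot> \<one>)" for n :: nat
    by (induction n) auto
  then show ?thesis using assms by simp
qed

text \<open>Put \<open>b = X - a\<close> and \<open>q = p ^ r\<close>. Additivity of the Frobenius
  map and \<open>a ^ q = a\<close> turn \<open>X ^ q - X\<close> into \<open>b ^ q - b\<close>. If
  \<open>b ^ 2\<close> divided this, cancelling one factor \<open>b\<close> would leave
  \<open>b\<close> dividing 1, although \<open>b\<close> is not constant.\<close>

lemma (in field) alg_mult_frobenius_poly_le_1:
  assumes p: "prime (p::nat)" and char: "[p] \<cdot> \<one> = \<zero>" and r: "0 < r"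
    and a: "a \<in> carrier R" "a [^] (p ^ r) = a"
  shows "alg_mult (X [^]\<^bsub>poly_ring R\<^esub> (p ^ r) \<ominus>\<^bsub>poly_ring R\<^esub> X) a \<le> 1"
proof (rule ccontr)
  let ?P = "poly_ring R"
  let ?f = "X [^]\<^bsub>?P\<^esub> (p ^ r) \<ominus>\<^bsub>?P\<^esub> X"
  let ?b = "[\<one>, \<ominus> a]" and ?c = "poly_of_const a"
  interpret P: domain ?P
    by (rule univ_poly_is_domain [OF carrier_is_subring])
  interpret C: ring_hom_ring R ?P poly_of_const
    using canonical_embedding_ring_hom [OF carrier_is_subring] by simp
  have X: "X \<in> carrier ?P" by (rule var_closed [OF carrier_is_subring])
  have b: "?b \<in> carrier ?P"
    using a by (simp add: univ_poly_def polynomial_def)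
  have c: "?c \<in> carrier ?P" using a by simp
  have Xbc: "X = ?b \<oplus>\<^bsub>?P\<^esub> ?c"
    using a by (auto simp: univ_poly_add var_def poly_of_const_def l_neg)
  \<comment> \<open>Since the exponent is at least 2, \<open>?b ^ (p ^ r)\<close> keeps a factor
    \<open>?b\<close> after one has been cancelled.\<close>
  have "2 \<le> p ^ r"
    using prime_ge_2_nat [OF p] r by (meson le_trans self_le_power one_le_numeral)
  then obtain n where n: "p ^ r = Suc (Suc n)"
    by (metis Suc_le_D numeral_2_eq_2 Suc_le_mono)
  assume "\<not> alg_mult ?f a \<le> 1"
  then have "2 \<le> alg_mult ?f a" by simp
  moreover have "?f \<in> carrier ?P" using X by simp
  ultimately have "(?b [^]\<^bsub>?P\<^esub> (2::nat)) pdivides ?f"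
    using le_alg_mult_imp_pdivides a by blast
  then obtain g where g: "g \<in> carrier ?P" and fg: "?f = (?b [^]\<^bsub>?P\<^esub> (2::nat)) \<otimes>\<^bsub>?P\<^esub> g"
    unfolding pdivides_def factor_def by blast
  have cq: "?c [^]\<^bsub>?P\<^esub> (p ^ r) = ?c"
    using a by (metis C.hom_nat_pow)
  have "X [^]\<^bsub>?P\<^esub> (p ^ r) = ?b [^]\<^bsub>?P\<^esub> (p ^ r) \<oplus>\<^bsub>?P\<^esub> ?c"
    unfolding Xbc using P.frobenius_add [OF p univ_poly_char [OF char] b c] cq by simp
  then have "?f = (?b [^]\<^bsub>?P\<^esub> (p ^ r) \<oplus>\<^bsub>?P\<^esub> ?c) \<ominus>\<^bsub>?P\<^esub> (?b \<oplus>\<^bsub>?P\<^esub> ?c)"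
    using Xbc by simp
  also have "\<dots> = ?b [^]\<^bsub>?P\<^esub> (p ^ r) \<ominus>\<^bsub>?P\<^esub> ?b"
    using b c by (simp add: P.minus_eq P.minus_add P.a_ac P.r_neg P.r_neg2
        del: P.nat_pow_Suc)
  also have "\<dots> = ?b \<otimes>\<^bsub>?P\<^esub> (?b \<otimes>\<^bsub>?P\<^esub> ?b [^]\<^bsub>?P\<^esub> n \<ominus>\<^bsub>?P\<^esub> \<one>\<^bsub>?P\<^esub>)"
    using b unfolding n by (simp add: P.minus_eq P.r_distr P.r_minus P.m_ac)
  also have "?f = ?b \<otimes>\<^bsub>?P\<^esub> (?b \<otimes>\<^bsub>?P\<^esub> g)"
    using b g unfolding fg by (simp add: numeral_2_eq_2 P.m_ac)
  finally have "?b \<otimes>\<^bsub>?P\<^esub> (?b \<otimes>\<^bsub>?P\<^esub> g) = ?b \<otimes>\<^bsub>?P\<^esub> (?b \<otimes>\<^bsub>?P\<^esub> ?b [^]\<^bsub>?P\<^esub> n \<ominus>\<^bsub>?P\<^esub> \<one>\<^bsub>?P\<^esub>)" .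
  then have "?b \<otimes>\<^bsub>?P\<^esub> g = ?b \<otimes>\<^bsub>?P\<^esub> ?b [^]\<^bsub>?P\<^esub> n \<ominus>\<^bsub>?P\<^esub> \<one>\<^bsub>?P\<^esub>"
    by (subst (asm) P.m_lcancel) (use b g in \<open>auto simp: univ_poly_zero\<close>)
  then have "?b \<otimes>\<^bsub>?P\<^esub> (?b [^]\<^bsub>?P\<^esub> n \<ominus>\<^bsub>?P\<^esub> g)
      = ?b \<otimes>\<^bsub>?P\<^esub> ?b [^]\<^bsub>?P\<^esub> n \<ominus>\<^bsub>?P\<^esub> (?b \<otimes>\<^bsub>?P\<^esub> ?b [^]\<^bsub>?P\<^esub> n \<ominus>\<^bsub>?P\<^esub> \<one>\<^bsub>?P\<^esub>)"
    using b g by (simp add: P.minus_eq P.r_distr P.r_minus)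
  also have "\<dots> = \<one>\<^bsub>?P\<^esub>"
    using b by (simp add: P.minus_eq P.minus_add P.r_neg2)
  finally have unit: "?b \<otimes>\<^bsub>?P\<^esub> (?b [^]\<^bsub>?P\<^esub> n \<ominus>\<^bsub>?P\<^esub> g) \<in> Units ?P"
    by (simp only: P.Units_one_closed)
  have "?b [^]\<^bsub>?P\<^esub> n \<ominus>\<^bsub>?P\<^esub> g \<in> carrier ?P" using b g by simp
  with unit b have "?b \<in> Units ?P" by (rule P.unit_factor)
  \<comment> \<open>Units of the polynomial ring are constants, hence coefficient lists of length 1,
    while \<open>?b\<close> has length 2.\<close>
  then have "?b \<in> {[k] |k. k \<in> carrier R - {\<zero>}}"
    using univ_poly_carrier_units_incl by (rule subsetD [rotated])
  then show False by blast
qed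

text \<open>Over an algebraically closed field \<open>X ^ (p ^ r) - X\<close> splits, so it has
  \<open>p ^ r\<close> roots counted with multiplicity; the roots are the fixed points, and each of
  them is simple.\<close>

lemma (in algebraically_closed) card_frobenius_fixed_points:
  assumes p: "prime (p::nat)" and char: "[p] \<cdot> \<one> = \<zero>" and r: "0 < r"
  shows "card {x \<in> carrier L. x [^] (p ^ r) = x} = p ^ r"
proof -
  let ?P = "poly_ring L"
  let ?f = "X [^]\<^bsub>?P\<^esub> (p ^ r) \<ominus>\<^bsub>?P\<^esub> X"
  let ?S = "{x \<in> carrier L. x [^] (p ^ r) = x}"
  interpret P: domain ?P
    by (rule univ_poly_is_domain [OF carrier_is_subring])
  have X: "X \<in> carrier ?P" by (rule var_closed [OF carrier_is_subring])
  then have f: "?f \<in> carrier ?P" by simp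
  have q: "1 < p ^ r"
    using prime_gt_1_nat [OF p] r by (rule one_less_power)
  \<comment> \<open>The list \<open>[\<ominus> \<one>, \<ominus> \<zero>]\<close> is
    \<open>- X\<close>; its degree 1 is below \<open>p ^ r\<close>, so the degree of the sum can be
    read off.\<close>
  have f_eq: "?f = poly_add (monom \<one> (p ^ r)) [\<ominus> \<one>, \<ominus> \<zero>]"
    using X by (simp add: P.minus_eq univ_poly_add unitary_monom_eq_var_pow [OF carrier_is_subring]
        univ_poly_a_inv_def' [OF carrier_is_subring]) (simp add: var_def)
  have "\<ominus> \<one> \<noteq> \<zero>"
    by (metis minus_minus minus_zero one_closed one_not_zero)
  then have deg: "degree ?f = p ^ r"
    unfolding f_eq using q r
    by (subst poly_add_degree_eq [OF carrier_is_subring])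
      (auto simp: monom_def polynomial_def simp del: nat_zero_less_power_iff)
  have "eval ?f x = x [^] (p ^ r) \<ominus> x" if x: "x \<in> carrier L" for x
    unfolding f_eq using x
    by (subst eval_poly_add) (auto simp: monom_in_carrier eval_monom minus_eq l_minus)
  moreover have "?f \<noteq> []" using deg q by (metis diff_0_eq_0 list.size(3) not_one_less_zero)
  ultimately have root: "is_root ?f x \<longleftrightarrow> x \<in> ?S" for x
    unfolding is_root_def using r_right_minus_eq [of "x [^] (p ^ r)" x]
    by (cases "x \<in> carrier L") simp_all
  then have S: "set_mset (roots ?f) = ?S"
    using roots_mem_iff_is_root [OF f] by blast
  have "count (roots ?f) x = 1" if "x \<in> ?S" for x
  proof -
    have "alg_mult ?f x \<le> 1"
      using that by (intro alg_mult_frobenius_poly_le_1 [OF p char r]) simp_all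
    moreover have "0 < alg_mult ?f x"
      using that root alg_mult_gt_zero_iff_is_root [OF f] by blast
    ultimately show ?thesis
      unfolding alg_mult_eq_count_roots [OF f] by linarith
  qed
  then have "size (roots ?f) = card ?S"
    unfolding size_multiset_overloaded_eq S by simp
  moreover have "size (roots ?f) = degree ?f"
    using roots_over_carrier [OF f] unfolding splitted_def .
  ultimately show ?thesis using deg by simp
qed

text \<open>The field consists of the fixed points of \<open>x \<mapsto> x ^ (p ^ r)\<close> in an
  algebraic closure of the residue ring modulo \<open>p\<close>. The element type is the one in
  which \<open>exists_closure\<close> constructs that closure.\<close>

lemma exists_domain_of_prime_power_card:
  assumes p: "prime (p::nat)" and r: "0 < r"
  shows "\<exists>F :: ((int list \<times> nat) multiset \<Rightarrow> int) ring.
    domain F \<and> card (carrier F) = p ^ r \<and> [p] \<cdot>\<^bsub>F\<^esub> \<one>\<^bsub>F\<^esub> = \<zero>\<^bsub>F\<^esub>"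
proof -
  define R where "R = residue_ring (int p)"
  interpret R: residues_prime p R
    by unfold_locales (use p in \<open>simp_all add: R_def\<close>)
  obtain L :: "((int list \<times> nat) multiset \<Rightarrow> int) ring"
    where L: "algebraic_closure L (ring.indexed_const R ` carrier R)"
      and hom: "ring.indexed_const R \<in> ring_hom R L"
    using R.exists_closure by blast
  interpret L: algebraic_closure L "ring.indexed_const R ` carrier R" by (rule L)
  interpret H: ring_hom_ring R L "ring.indexed_const R"
    by (rule ring_hom_ringI2 [OF R.ring_axioms L.ring_axioms hom])
  have "[n] \<cdot>\<^bsub>R\<^esub> \<one>\<^bsub>R\<^esub> = int n mod int p" for n :: nat
  proof (induction n)
    case (Suc n)
    then show ?case by (simp add: R.res_one_eq R.res_add_eq mod_simps add.commute)
  qed (simp add: R.res_zero_eq)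
  then have charR: "[p] \<cdot>\<^bsub>R\<^esub> \<one>\<^bsub>R\<^esub> = \<zero>\<^bsub>R\<^esub>" by (simp add: R.res_zero_eq)
  have "[n] \<cdot>\<^bsub>L\<^esub> \<one>\<^bsub>L\<^esub> = ring.indexed_const R ([n] \<cdot>\<^bsub>R\<^esub> \<one>\<^bsub>R\<^esub>)" for n :: nat
    by (induction n) auto
  then have char: "[p] \<cdot>\<^bsub>L\<^esub> \<one>\<^bsub>L\<^esub> = \<zero>\<^bsub>L\<^esub>" using charR by simp
  define S where "S = {x \<in> carrier L. x [^]\<^bsub>L\<^esub> (p ^ r) = x}"
  have q: "0 < p ^ r" using prime_gt_0_nat [OF p] by simp
  have sum: "x \<oplus>\<^bsub>L\<^esub> y \<in> S" if "x \<in> S" "y \<in> S" for x y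
    using that L.frobenius_add [OF p char] by (simp add: S_def)
  have "subring S L"
  proof (rule L.subringI)
    fix x assume x: "x \<in> S"
    \<comment> \<open>With \<open>q = p ^ r\<close>, the equation
      \<open>0 = (x + (- x)) ^ q = x + (- x) ^ q\<close> shows \<open>(- x) ^ q = - x\<close>, for
      even and odd \<open>q\<close> alike.\<close>
    have "x [^]\<^bsub>L\<^esub> (p ^ r) \<oplus>\<^bsub>L\<^esub> (\<ominus>\<^bsub>L\<^esub> x) [^]\<^bsub>L\<^esub> (p ^ r) = \<zero>\<^bsub>L\<^esub>"
      using x L.frobenius_add [OF p char, of x "\<ominus>\<^bsub>L\<^esub> x" r] q
      by (simp add: S_def L.r_neg L.nat_pow_zero)
    then show "\<ominus>\<^bsub>L\<^esub> x \<in> S"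
      using x L.minus_equality [of "(\<ominus>\<^bsub>L\<^esub> x) [^]\<^bsub>L\<^esub> (p ^ r)" x]
      by (simp add: S_def L.a_comm)
  qed (use sum in \<open>auto simp: S_def L.nat_pow_distrib\<close>)
  then have "domain (L\<lparr>carrier := S\<rparr>)" by (rule L.subring_is_domain)
  moreover have "[p] \<cdot>\<^bsub>L\<lparr>carrier := S\<rparr>\<^esub> \<one>\<^bsub>L\<^esub> = \<zero>\<^bsub>L\<^esub>"
    using char by (simp add: add_pow_def nat_pow_def)
  ultimately show ?thesis
    using L.card_frobenius_fixed_points [OF p char r]
    by (intro exI [of _ "L\<lparr>carrier := S\<rparr>"]) (simp add: S_def)
qed

subsection \<open>A parabola modulo a prime power\<close>

definition additive_map :: "('a, 'b) ring_scheme \<Rightarrow> ((nat \<Rightarrow> int) \<Rightarrow> 'a) \<Rightarrow> bool" where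
  "additive_map G h \<longleftrightarrow> (\<forall>c. h c \<in> carrier G) \<and> (\<forall>c d. h (\<lambda>i. c i + d i) = h c \<oplus>\<^bsub>G\<^esub> h d)"

text \<open>Such an \<open>h\<close> amounts to \<open>n\<close> independent vectors over the prime
  field. Coordinates are integers rather than residues, so that structure constants read off from
  them can be reused modulo \<open>p ^ k\<close>; entries from index \<open>n\<close> on have no
  influence on \<open>h\<close>.\<close>

definition coordinate_map :: "('a, 'b) ring_scheme \<Rightarrow> nat \<Rightarrow> nat \<Rightarrow> ((nat \<Rightarrow> int) \<Rightarrow> 'a) \<Rightarrow> bool" where
  "coordinate_map G p n h \<longleftrightarrow>
     additive_map G h \<and> (\<forall>c. h c = \<zero>\<^bsub>G\<^esub> \<longleftrightarrow> (\<forall>i<n. int p dvd c i))"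

definition unit_vector :: "nat \<Rightarrow> nat \<Rightarrow> int" where
  "unit_vector i = (\<lambda>j. if j = i then 1 else 0)"

lemma (in abelian_group) additive_map_diff:
  assumes h: "additive_map G h"
  shows "h (\<lambda>i. c i - d i) = h c \<ominus> h d"
proof -
  have hc: "h c \<in> carrier G" for c using h by (simp add: additive_map_def)
  have "h c = h (\<lambda>i. (c i - d i) + d i)" by simp
  also have "\<dots> = h (\<lambda>i. c i - d i) \<oplus> h d"
    using h unfolding additive_map_def by (elim conjE allE) assumption
  finally have "h c \<ominus> h d = h (\<lambda>i. c i - d i) \<oplus> h d \<ominus> h d" by simp
  also have "\<dots> = h (\<lambda>i. c i - d i)"
    using hc by (simp add: minus_eq a_assoc r_neg)
  finally show ?thesis by simp
qed

lemma (in abelian_group) minus_eq_zero_iff: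
  assumes "a \<in> carrier G" "b \<in> carrier G"
  shows "a \<ominus> b = \<zero> \<longleftrightarrow> a = b"
proof
  assume "a \<ominus> b = \<zero>"
  then have "a \<ominus> b \<oplus> b = b" using assms by simp
  then show "a = b" using assms by (simp add: minus_eq a_assoc l_neg)
qed (use assms in \<open>simp add: minus_eq r_neg\<close>)

lemma (in abelian_group) coordinate_map_eq_iff:
  assumes h: "coordinate_map G p n h"
  shows "h c = h d \<longleftrightarrow> (\<forall>i<n. int p dvd c i - d i)"
proof -
  have "h c = h d \<longleftrightarrow> h (\<lambda>i. c i - d i) = \<zero>"
    using h additive_map_diff [of h c d]
    by (simp add: coordinate_map_def additive_map_def minus_eq_zero_iff)
  then show ?thesis using h by (simp add: coordinate_map_def)
qed

lemma (in abelian_group) card_range_coordinate_map: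
  assumes h: "coordinate_map G p n h" and p: "0 < p"
  shows "card (range h) = p ^ n" "finite (range h)"
proof -
  let ?D = "{..<n} \<rightarrow>\<^sub>E {0..<int p}"
  have "h c \<in> h ` ?D" for c
  proof (rule image_eqI)
    show "h c = h (\<lambda>i\<in>{..<n}. c i mod int p)"
      unfolding coordinate_map_eq_iff [OF h] by (simp add: minus_mod_eq_mult_div)
    show "(\<lambda>i\<in>{..<n}. c i mod int p) \<in> ?D" using p by auto
  qed
  then have range: "range h = h ` ?D" by blast
  have "inj_on h ?D"
  proof (rule inj_onI)
    fix c d assume c: "c \<in> ?D" and d: "d \<in> ?D" and "h c = h d"
    then have dvd: "int p dvd c i - d i" if "i < n" for i
      using that unfolding coordinate_map_eq_iff [OF h] by blast
    show "c = d"
    proof (rule PiE_ext [OF c d])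
      fix i assume i: "i \<in> {..<n}"
      have "c i mod int p = d i mod int p"
        using dvd i by (simp add: mod_eq_dvd_iff)
      moreover have "c i \<in> {0..<int p}" "d i \<in> {0..<int p}"
        by (rule PiE_mem [OF c i], rule PiE_mem [OF d i])
      ultimately show "c i = d i" by simp
    qed
  qed
  then show "card (range h) = p ^ n"
    unfolding range by (simp add: card_image card_PiE)
  show "finite (range h)"
    unfolding range by (simp add: finite_PiE)
qed

text \<open>A basis is built one vector at a time: for \<open>n < r\<close> the \<open>p ^ n\<close>
  values of \<open>h\<close> do not exhaust the group, and any \<open>v\<close> outside the range
  extends \<open>h\<close>.\<close>

lemma (in abelian_group) exists_coordinate_map:
  assumes p: "prime (p::nat)" and exponent: "\<And>x. x \<in> carrier G \<Longrightarrow> [p] \<cdot> x = \<zero>"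
    and card: "card (carrier G) = p ^ r" and n: "n \<le> r"
  shows "\<exists>h. coordinate_map G p n h"
  using n
proof (induction n)
  case 0
  show ?case
    by (rule exI [of _ "\<lambda>_. \<zero>"]) (simp add: coordinate_map_def additive_map_def)
next
  case (Suc n)
  then obtain h where h: "coordinate_map G p n h" by auto
  then have add: "additive_map G h" by (simp add: coordinate_map_def)
  then have hc [simp]: "h c \<in> carrier G" for c by (simp add: additive_map_def)
  have hadd: "h (\<lambda>i. c i + d i) = h c \<oplus> h d" for c d
    using add by (simp add: additive_map_def)
  have hpow: "h (\<lambda>i. k * c i) = [k] \<cdot> h c" for k :: int and c
  proof (induction k rule: int_induct [of _ 0])
    case base
    have "h (\<lambda>i. 0) = \<zero>" using h by (simp add: coordinate_map_def)
    then show ?case by (simp add: add_pow_def)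
  next
    case (step1 k)
    then show ?case using hadd [of "\<lambda>i. k * c i" c] by (simp add: algebra_simps a_comm add.int_pow_mult)
  next
    case (step2 k)
    have "h (\<lambda>i. (k - 1) * c i) = h (\<lambda>i. k * c i) \<ominus> h c"
      using additive_map_diff [OF add, of "\<lambda>i. k * c i" c] by (simp add: algebra_simps)
    then show ?case using step2 by (simp add: add.int_pow_diff minus_eq a_inv_def)
  qed
  have "p ^ n < p ^ r"
    using prime_gt_1_nat [OF p] Suc.prems by (intro power_strict_increasing) auto
  then have "range h \<noteq> carrier G"
    using card_range_coordinate_map [OF h prime_gt_0_nat [OF p]] card by auto
  then obtain v where v: "v \<in> carrier G" "v \<notin> range h" using hc by blast
  have int_exponent: "[(int p * k)] \<cdot> x = \<zero>" if "x \<in> carrier G" for x and k :: int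
  proof -
    have "[int p] \<cdot> x = \<zero>" using that exponent [of x] by (simp add: add_pow_def int_pow_int)
    then show ?thesis
      using that add.int_pow_pow [of x k "int p"] by simp
  qed
  let ?h = "\<lambda>c. h c \<oplus> [(c n)] \<cdot> v"
  have "additive_map G ?h"
    using v hadd by (simp add: additive_map_def add.int_pow_mult a_ac)
  moreover have "?h c = \<zero> \<longleftrightarrow> (\<forall>i<Suc n. int p dvd c i)" for c
  proof
    assume zero: "?h c = \<zero>"
    have "int p dvd c n"
    proof (rule ccontr)
      assume "\<not> int p dvd c n"
      then have "coprime (c n) (int p)"
        using p by (simp add: coprime_commute prime_imp_coprime)
      \<comment> \<open>With \<open>u\<close> inverse to \<open>c n\<close> modulo \<open>p\<close>,
        multiplying \<open>[(c n)] \<cdot> v = \<ominus> h c\<close> by \<open>u\<close> puts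
        \<open>v\<close> into the range of \<open>h\<close>, a contradiction.\<close>
      then obtain u where "[c n * u = 1] (mod int p)"
        using cong_solve_coprime_int by blast
      then obtain t where t: "c n * u = 1 + int p * t"
        by (metis cong_iff_lin cong_sym mult.commute)
      have "[(c n)] \<cdot> v = \<ominus> h c"
        using zero v by (metis hc a_comm add.int_pow_closed minus_equality minus_minus)
      then have "[u] \<cdot> (\<ominus> h c) = [(c n * u)] \<cdot> v"
        using v add.int_pow_pow [of v u "c n"] by simp
      also have "\<dots> = v"
        using v int_exponent [of v t] unfolding t by (simp add: add.int_pow_mult)
      also have "\<ominus> h c = h (\<lambda>i. 0 - c i)"
      proof -
        have "h (\<lambda>i. 0) = \<zero>" using h by (simp add: coordinate_map_def)
        then show ?thesis
          using additive_map_diff [OF add, of "\<lambda>i. 0" c] by (simp add: minus_eq)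
      qed
      also have "[u] \<cdot> \<dots> = h (\<lambda>i. u * (0 - c i))" by (rule hpow [symmetric])
      finally show False using v by blast
    qed
    moreover from this have "[(c n)] \<cdot> v = \<zero>" using int_exponent v by auto
    with zero have "h c = \<zero>" by simp
    then have "\<forall>i<n. int p dvd c i" using h by (simp add: coordinate_map_def)
    ultimately show "\<forall>i<Suc n. int p dvd c i" using less_antisym by blast
  next
    assume dvd: "\<forall>i<Suc n. int p dvd c i"
    then have "h c = \<zero>" using h by (simp add: coordinate_map_def)
    moreover have "int p dvd c n" using dvd by blast
    then have "[(c n)] \<cdot> v = \<zero>" using int_exponent v by auto
    ultimately show "?h c = \<zero>" by simp
  qed
  ultimately show ?case unfolding coordinate_map_def by blast
qed

text \<open>Additivity implies compatibility with integer multiples, so agreement on unit vectors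
  propagates coordinate by coordinate.\<close>

lemma (in abelian_group) additive_map_eqI:
  assumes g: "additive_map G g" and h: "additive_map G h"
    and basis: "\<And>i. i < n \<Longrightarrow> g (unit_vector i) = h (unit_vector i)"
    and support: "\<And>i. n \<le> i \<Longrightarrow> c i = 0"
  shows "g c = h c"
  using basis support
proof (induction n arbitrary: c)
  case 0
  then have c: "c = (\<lambda>i. c i - c i)" by auto
  have "f (\<lambda>i. c i - c i) = \<zero>" if f: "additive_map G f" for f
    unfolding additive_map_diff [OF f] using f by (simp add: additive_map_def minus_eq_zero_iff)
  then show ?case using g h c by metis
next
  case (Suc n)
  have multiple: "g (\<lambda>i. k * unit_vector n i) = h (\<lambda>i. k * unit_vector n i)" for k :: int
  proof (induction k rule: int_induct [of _ 0])
    case base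
    show ?case using Suc.IH [of "\<lambda>i. 0"] Suc.prems by simp
  next
    case (step1 k)
    then show ?case
      using g h Suc.prems(1) [of n] by (simp add: additive_map_def distrib_right)
  next
    case (step2 k)
    then show ?case
      using Suc.prems(1) [of n] by (simp add: left_diff_distrib additive_map_diff [OF g] additive_map_diff [OF h])
  qed
  have c: "c = (\<lambda>i. (if i = n then 0 else c i) + c n * unit_vector n i)"
    by (auto simp: unit_vector_def)
  have "g (\<lambda>i. if i = n then 0 else c i) = h (\<lambda>i. if i = n then 0 else c i)"
    by (rule Suc.IH) (use Suc.prems in auto)
  with multiple show ?case
    by (subst (1 2) c) (use g h in \<open>simp add: additive_map_def\<close>)
qed

section \<open>Symmetric bilinear maps without zero divisors modulo \<open>p\<close>\<close>

definition bilinear_map ::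
  "nat \<Rightarrow> (nat \<Rightarrow> nat \<Rightarrow> nat \<Rightarrow> int) \<Rightarrow> (nat \<Rightarrow> int) \<Rightarrow> (nat \<Rightarrow> int) \<Rightarrow> nat \<Rightarrow> int"
  where "bilinear_map r C x y = (\<lambda>l. \<Sum>i<r. \<Sum>j<r. x i * y j * C i j l)"

lemma bilinear_map_add_left:
  "bilinear_map r C (\<lambda>i. x i + x' i) y l = bilinear_map r C x y l + bilinear_map r C x' y l"
  by (simp add: bilinear_map_def distrib_right sum.distrib)

lemma bilinear_map_add_right:
  "bilinear_map r C x (\<lambda>i. y i + y' i) l = bilinear_map r C x y l + bilinear_map r C x y' l"
  by (simp add: bilinear_map_def distrib_right distrib_left sum.distrib)

lemma bilinear_map_commute:
  assumes "\<And>i j l. C i j l = C j i l"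
  shows "bilinear_map r C x y l = bilinear_map r C y x l"
  unfolding bilinear_map_def
  by (subst sum.swap) (simp add: assms [of _ _ l] mult.commute mult.left_commute)

lemma bilinear_map_unit_vectors:
  assumes "i < r" "j < r"
  shows "bilinear_map r C (unit_vector i) (unit_vector j) = C i j"
proof
  fix l
  have "bilinear_map r C (unit_vector i) (unit_vector j) l
      = (\<Sum>i'<r. \<Sum>j'<r. if i' = i then if j' = j then C i j l else 0 else 0)"
    unfolding bilinear_map_def unit_vector_def by (intro sum.cong refl) auto
  also have "\<dots> = (\<Sum>i'<r. if i' = i then \<Sum>j'<r. if j' = j then C i j l else 0 else 0)"
    by (intro sum.cong refl) auto
  finally show "bilinear_map r C (unit_vector i) (unit_vector j) l = C i j l"
    using assms by simp
qed

text \<open>The structure constants of a field with \<open>p ^ r\<close> elements with respect to a basis over its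
  prime field.\<close>

lemma exists_bilinear_map_without_zero_divisors:
  assumes p: "prime (p::nat)"
  shows "\<exists>C. (\<forall>i j l. C i j l = C j i l) \<and>
    (\<forall>x y. (\<forall>l<r. int p dvd bilinear_map r C x y l) \<longrightarrow>
       (\<forall>i<r. int p dvd x i) \<or> (\<forall>i<r. int p dvd y i))"
proof (cases "r = 0")
  \<comment> \<open>No field has \<open>p ^ 0 = 1\<close> element; the claim is trivial here, since
    no index lies below \<open>r\<close>.\<close>
  case True
  then show ?thesis by auto
next
  case False
  then obtain F :: "((int list \<times> nat) multiset \<Rightarrow> int) ring"
    where F: "domain F" and card: "card (carrier F) = p ^ r"
      and char: "[p] \<cdot>\<^bsub>F\<^esub> \<one>\<^bsub>F\<^esub> = \<zero>\<^bsub>F\<^esub>"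
    using exists_domain_of_prime_power_card [OF p] by blast
  interpret domain F by (rule F)
  have "[p] \<cdot>\<^bsub>F\<^esub> x = \<zero>\<^bsub>F\<^esub>" if "x \<in> carrier F" for x
    using that char add_pow_ldistr [of "\<one>\<^bsub>F\<^esub>" x p] by simp
  then obtain h where h: "coordinate_map F p r h"
    using exists_coordinate_map [OF p _ card order_refl] by blast
  then have add: "additive_map F h" by (simp add: coordinate_map_def)
  then have hc [simp]: "h c \<in> carrier F" for c by (simp add: additive_map_def)
  have hadd: "h (\<lambda>i. c i + d i) = h c \<oplus>\<^bsub>F\<^esub> h d" for c d
    using add by (simp add: additive_map_def)
  \<comment> \<open>Both sets have \<open>p ^ r\<close> elements, so every field element has integer
    coordinates.\<close>
  have "range h = carrier F"
  proof (rule card_subset_eq)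
    have "0 < card (carrier F)" using card p by (simp add: prime_gt_0_nat)
    then show "finite (carrier F)" by (rule card_ge_0_finite)
    show "card (range h) = card (carrier F)"
      using card card_range_coordinate_map [OF h prime_gt_0_nat [OF p]] by simp
  qed auto
  then have inv: "h (inv_into UNIV h a) = a" if "a \<in> carrier F" for a
    using that by (simp add: f_inv_into_f)
  \<comment> \<open>\<open>C i j\<close> is a choice of integer coordinates for the product of the
    basis vectors \<open>i\<close> and \<open>j\<close>. The choice depends on the product only,
    which makes \<open>C\<close> symmetric.\<close>
  define C where "C i j = inv_into UNIV h (h (unit_vector i) \<otimes>\<^bsub>F\<^esub> h (unit_vector j))" for i j
  have C: "C i j l = C j i l" for i j l
    by (simp add: C_def m_comm)
  \<comment> \<open>Multiplicativity is first shown against a basis vector on the right, by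
    linearity in \<open>x\<close>, and then for general \<open>y\<close>, by linearity in
    \<open>y\<close>.\<close>
  have unit_right: "h (bilinear_map r C x (unit_vector j)) = h x \<otimes>\<^bsub>F\<^esub> h (unit_vector j)"
    if "j < r" and "\<And>i. r \<le> i \<Longrightarrow> x i = 0" for x j
    using that(2)
  proof (rule additive_map_eqI [where n = r, rotated -1])
    show "additive_map F (\<lambda>x. h (bilinear_map r C x (unit_vector j)))"
      unfolding additive_map_def bilinear_map_add_left hadd by simp
    show "additive_map F (\<lambda>x. h x \<otimes>\<^bsub>F\<^esub> h (unit_vector j))"
      unfolding additive_map_def by (simp add: hadd l_distr)
    show "h (bilinear_map r C (unit_vector i) (unit_vector j))
        = h (unit_vector i) \<otimes>\<^bsub>F\<^esub> h (unit_vector j)" if "i < r" for i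
      using that \<open>j < r\<close> by (simp add: bilinear_map_unit_vectors C_def inv)
  qed
  have supported: "h (bilinear_map r C x y) = h x \<otimes>\<^bsub>F\<^esub> h y"
    if x: "\<And>i. r \<le> i \<Longrightarrow> x i = 0" and y: "\<And>i. r \<le> i \<Longrightarrow> y i = 0" for x y
    using y
  proof (rule additive_map_eqI [where n = r, rotated -1])
    show "additive_map F (\<lambda>y. h (bilinear_map r C x y))"
      unfolding additive_map_def bilinear_map_add_right hadd by simp
    show "additive_map F (\<lambda>y. h x \<otimes>\<^bsub>F\<^esub> h y)"
      unfolding additive_map_def by (simp add: hadd r_distr)
  qed (auto intro: unit_right x)
  have mult: "h (bilinear_map r C x y) = h x \<otimes>\<^bsub>F\<^esub> h y" for x y
  proof -
    \<comment> \<open>Entries from index \<open>r\<close> on are cut off; neither \<open>h\<close>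
      nor the bilinear map sees them.\<close>
    let ?x = "\<lambda>i. if i < r then x i else 0" and ?y = "\<lambda>i. if i < r then y i else 0"
    have "h (bilinear_map r C ?x ?y) = h ?x \<otimes>\<^bsub>F\<^esub> h ?y"
      by (rule supported) auto
    moreover have "bilinear_map r C ?x ?y = bilinear_map r C x y"
      by (auto simp: bilinear_map_def intro!: sum.cong)
    moreover have "h ?x = h x" "h ?y = h y"
      by (simp_all add: coordinate_map_eq_iff [OF h])
    ultimately show ?thesis by simp
  qed
  have zero: "h x = \<zero>\<^bsub>F\<^esub> \<longleftrightarrow> (\<forall>i<r. int p dvd x i)" for x
    using h by (simp add: coordinate_map_def)
  show ?thesis
  proof (intro exI [of _ C] conjI allI impI C)
    fix x y assume "\<forall>l<r. int p dvd bilinear_map r C x y l"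
    then have "h x \<otimes>\<^bsub>F\<^esub> h y = \<zero>\<^bsub>F\<^esub>" using zero mult by metis
    then show "(\<forall>i<r. int p dvd x i) \<or> (\<forall>i<r. int p dvd y i)"
      using integral [of "h x" "h y"] zero by simp
  qed
qed

text \<open>The witness is the square \<open>f x = ?B x x\<close> of a bilinear map without zero
  divisors modulo \<open>p\<close>. One \<open>f\<close> serves all exponents \<open>k\<close>; the
  first clause allows its arguments to be replaced by residues.\<close>

lemma exists_planar_function:
  assumes p: "prime (p::nat)" and odd: "odd p"
  shows "\<exists>f :: (nat \<Rightarrow> int) \<Rightarrow> nat \<Rightarrow> int.
    (\<forall>n x y. (\<forall>i<r. [x i = y i] (mod n)) \<longrightarrow> (\<forall>l<r. [f x l = f y l] (mod n))) \<and>
    (\<forall>k d e. \<not> (\<forall>i<r. int p dvd d i) \<longrightarrow>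
       (\<exists>x. \<forall>l<r. [f (\<lambda>i. x i + d i) l - f x l = e l] (mod int p ^ k)))"
proof -
  obtain C where C: "\<And>i j l. C i j l = C j i l"
    and integral: "\<And>x y. \<forall>l<r. int p dvd bilinear_map r C x y l \<Longrightarrow>
      (\<forall>i<r. int p dvd x i) \<or> (\<forall>i<r. int p dvd y i)"
    using exists_bilinear_map_without_zero_divisors [OF p, of r] by metis
  let ?B = "bilinear_map r C"
  have cong: "[?B x x l = ?B y y l] (mod n)"
    if "\<forall>i<r. [x i = y i] (mod n)" for n x y l
    unfolding bilinear_map_def using that by (intro cong_sum cong_mult cong_refl) auto
  have diff: "?B (\<lambda>i. x i + d i) (\<lambda>i. x i + d i) l - ?B x x l = 2 * ?B x d l + ?B d d l" for x d l
    using bilinear_map_commute [of C r d x l, OF C]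
    by (simp add: bilinear_map_add_left bilinear_map_add_right)
  \<comment> \<open>Absence of zero divisors lifts from \<open>p\<close> to \<open>p ^ k\<close> by
    descent: divisibility of \<open>?B x d\<close> by \<open>p\<close> forces
    \<open>x = p * z\<close>, and one power of \<open>p\<close> fewer remains for
    \<open>z\<close>.\<close>
  have kernel: "\<forall>i<r. int p ^ k dvd x i"
    if d: "\<not> (\<forall>i<r. int p dvd d i)" and "\<forall>l<r. int p ^ k dvd ?B x d l" for k x d
    using that(2)
  proof (induction k arbitrary: x)
    case (Suc k)
    have "\<forall>l<r. int p dvd ?B x d l"
      using Suc.prems by (auto dest: dvd_mult_left)
    then have dvd: "\<forall>i<r. int p dvd x i" using integral d by blast
    define z where "z i = x i div int p" for i
    have x: "x i = int p * z i" if "i < r" for i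
      using that dvd by (simp add: z_def)
    have "?B x d l = int p * ?B z d l" for l
      unfolding bilinear_map_def sum_distrib_left
      by (intro sum.cong refl) (simp add: x)
    then have "\<forall>l<r. int p ^ k dvd ?B z d l"
      using Suc.prems p by (simp add: prime_gt_0_nat)
    from Suc.IH [OF this] show ?case by (simp add: x)
  qed simp
  have "\<exists>x. \<forall>l<r. [?B (\<lambda>i. x i + d i) (\<lambda>i. x i + d i) l - ?B x x l = e l] (mod int p ^ k)"
    if d: "\<not> (\<forall>i<r. int p dvd d i)" for k d e
  proof -
    define N where "N = int p ^ k"
    have N: "0 < N" using p by (simp add: N_def prime_gt_0_nat)
    let ?D = "{..<r} \<rightarrow>\<^sub>E {0..<N}"
    \<comment> \<open>By \<open>diff\<close>, \<open>?g x\<close> is the increment of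
      \<open>f\<close> at \<open>x\<close> in direction \<open>d\<close>, reduced into
      \<open>?D\<close>. As an injective self-map of a finite set it is onto.\<close>
    let ?g = "\<lambda>x. \<lambda>l\<in>{..<r}. (2 * ?B x d l + ?B d d l) mod N"
    have inj: "inj_on ?g ?D"
    proof (rule inj_onI)
      fix x y assume x: "x \<in> ?D" and y: "y \<in> ?D" and eq: "?g x = ?g y"
      have dvd_B: "N dvd ?B (\<lambda>i. x i - y i) d l" if "l < r" for l
      proof -
        have "?B x d l = ?B (\<lambda>i. x i - y i) d l + ?B y d l"
          using bilinear_map_add_left [of r C "\<lambda>i. x i - y i" y d l] by simp
        moreover have "(2 * ?B x d l + ?B d d l) mod N = (2 * ?B y d l + ?B d d l) mod N"
          using fun_cong [OF eq, of l] that by simp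
        ultimately have "N dvd 2 * ?B (\<lambda>i. x i - y i) d l"
          by (simp add: mod_eq_dvd_iff)
        \<comment> \<open>Oddness of \<open>p\<close> enters here: the factor 2 from the two equal
          cross terms can be cancelled.\<close>
        moreover have "coprime N 2"
          using odd by (simp add: N_def)
        ultimately show ?thesis by (simp add: coprime_dvd_mult_right_iff)
      qed
      have dvd: "\<forall>i<r. N dvd x i - y i"
        using kernel [OF d, of k "\<lambda>i. x i - y i"] dvd_B by (simp add: N_def)
      show "x = y"
      proof (rule PiE_ext [OF x y])
        fix i assume i: "i \<in> {..<r}"
        have "x i mod N = y i mod N"
          using dvd i by (simp add: mod_eq_dvd_iff)
        moreover have "x i \<in> {0..<N}" "y i \<in> {0..<N}"
          by (rule PiE_mem [OF x i], rule PiE_mem [OF y i])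
        ultimately show "x i = y i" by simp
      qed
    qed
    have "?g ` ?D = ?D"
    proof (rule endo_inj_surj [OF _ _ inj])
      show "finite ?D" by (simp add: finite_PiE)
      show "?g ` ?D \<subseteq> ?D"
        by (intro image_subsetI) (simp add: restrict_PiE_iff N)
    qed
    moreover have "(\<lambda>l\<in>{..<r}. e l mod N) \<in> ?D"
      by (simp add: restrict_PiE_iff N)
    ultimately have "(\<lambda>l\<in>{..<r}. e l mod N) \<in> ?g ` ?D" by (simp only:)
    then obtain x where x: "(\<lambda>l\<in>{..<r}. e l mod N) = ?g x" by (rule imageE)
    have "[?B (\<lambda>i. x i + d i) (\<lambda>i. x i + d i) l - ?B x x l = e l] (mod N)" if "l < r" for l
      using fun_cong [OF x, of l] that unfolding diff by (simp add: cong_def)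
    then show ?thesis unfolding N_def by blast
  qed
  with cong show ?thesis
    by (intro exI [of _ "\<lambda>x. ?B x x"]) blast
qed

subsection \<open>Difference bases of products of cyclic groups\<close>

lemma difference_size_le:
  assumes "difference_basis G A B" "finite B"
  shows "difference_size G A \<le> card B"
  unfolding difference_size_def using assms by (intro Least_le) blast

lemma (in group) obtain_minimal_difference_basis:
  assumes "finite (carrier G)"
  obtains B where "difference_basis G (carrier G) B" "finite B" "card B = group_difference_size G"
    "B \<noteq> {}"
proof -
  have "difference_basis G (carrier G) (carrier G)"
    unfolding difference_basis_def by (metis inv_one one_closed order_refl r_one)
  then have "\<exists>n B. difference_basis G (carrier G) B \<and> finite B \<and> card B = n"
    using assms by blast
  from LeastI_ex [OF this] obtain B where B: "difference_basis G (carrier G) B" "finite B"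
      "card B = group_difference_size G" unfolding difference_size_def by blast
  moreover have "B \<noteq> {}"
    using B(1) one_closed unfolding difference_basis_def by blast
  ultimately show ?thesis by (rule that)
qed

lemma (in comm_group) mult_div_mult:
  assumes "a \<in> carrier G" "b \<in> carrier G" "c \<in> carrier G" "d \<in> carrier G"
  shows "(a \<otimes> b) \<otimes> inv (c \<otimes> d) = (a \<otimes> inv c) \<otimes> (b \<otimes> inv d)"
  using assms by (simp add: inv_mult m_ac)

text \<open>Take minimal difference bases \<open>B\<close> of \<open>H\<close> and \<open>C\<close>
  of \<open>K\<close>. The products of \<open>T\<close> with the image of \<open>B\<close> handle
  the second alternative of \<open>cover\<close>, a translate of the image of \<open>C\<close> the
  first. Translating so that the two sets meet saves one element, which is the
  \<open>Suc\<close>.\<close>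

lemma (in comm_group) Suc_difference_size_le:
  assumes H: "group H" "finite (carrier H)" and h: "h \<in> hom H G"
    and K: "group K" "finite (carrier K)" and k: "k \<in> hom K G"
    and T: "T \<subseteq> carrier G" "finite T" "T \<noteq> {}"
    and cover: "\<And>g. g \<in> carrier G \<Longrightarrow>
      g \<in> k ` carrier K \<or> (\<exists>x\<in>T. \<exists>y\<in>T. g \<otimes> inv x \<otimes> y \<in> h ` carrier H)"
  shows "Suc (group_difference_size G) \<le> group_difference_size H * card T + group_difference_size K"
proof -
  interpret h: group_hom H G h
    using H h by (simp add: group_hom_def group_hom_axioms_def is_group)
  interpret k: group_hom K G k
    using K k by (simp add: group_hom_def group_hom_axioms_def is_group)
  obtain B where B: "difference_basis H (carrier H) B" "finite B"
      "card B = group_difference_size H" "B \<noteq> {}"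
    using group.obtain_minimal_difference_basis [OF H] .
  obtain C where C: "difference_basis K (carrier K) C" "finite C"
      "card C = group_difference_size K" "C \<noteq> {}"
    using group.obtain_minimal_difference_basis [OF K] .
  have BH: "B \<subseteq> carrier H" and CK: "C \<subseteq> carrier K"
    using B(1) C(1) by (auto simp: difference_basis_def)
  define D where "D = (\<lambda>(t, b). t \<otimes> h b) ` (T \<times> B)"
  have "t \<otimes> h b \<in> carrier G" if "t \<in> T" "b \<in> B" for t b
    using that T(1) BH by (intro m_closed h.hom_closed) auto
  then have D: "D \<subseteq> carrier G" "finite D" "D \<noteq> {}"
    using T B by (auto simp: D_def)
  obtain d c where d: "d \<in> D" and c: "c \<in> C" using D(3) C(4) by blast
  have [simp]: "d \<in> carrier G" "c \<in> carrier K" using d D c CK by auto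
  \<comment> \<open>The translation moves \<open>k c\<close> to the point \<open>d\<close> of
    \<open>D\<close> and leaves all differences unchanged.\<close>
  define E where "E = (\<lambda>b. d \<otimes> inv (k c) \<otimes> k b) ` C"
  have E: "E \<subseteq> carrier G" "finite E"
    using C CK by (auto simp: E_def)
  have "d \<otimes> inv (k c) \<otimes> k c = d" by (simp add: m_assoc)
  then have "d \<in> E" unfolding E_def using c by (metis imageI)
  then have "0 < card (D \<inter> E)" using d D(2) by (auto simp: card_gt_0_iff)
  then have "Suc (card (D \<union> E)) \<le> card D + card E"
    using card_Un_Int [OF D(2) E(2)] by simp
  also have "card D \<le> card (T \<times> B)"
    unfolding D_def using T(2) B(2) by (intro card_image_le) simp
  also have "card E \<le> card C"
    unfolding E_def using C(2) by (intro card_image_le)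
  finally have "Suc (card (D \<union> E)) \<le> group_difference_size H * card T + group_difference_size K"
    by (simp add: B C card_cartesian_product mult.commute)
  moreover have "difference_basis G (carrier G) (D \<union> E)"
    unfolding difference_basis_def
  proof (intro conjI ballI)
    show "D \<union> E \<subseteq> carrier G" using D E by simp
    fix g assume g: "g \<in> carrier G"
    from cover [OF g] show "\<exists>x\<in>D \<union> E. \<exists>y\<in>D \<union> E. g = x \<otimes> inv y"
    proof
      assume "g \<in> k ` carrier K"
      then obtain a where "a \<in> carrier K" "g = k a" by blast
      moreover from C(1) \<open>a \<in> carrier K\<close> obtain x y
        where x: "x \<in> C" and y: "y \<in> C" and "a = x \<otimes>\<^bsub>K\<^esub> inv\<^bsub>K\<^esub> y"
        unfolding difference_basis_def by auto
      ultimately have gxy: "g = k (x \<otimes>\<^bsub>K\<^esub> inv\<^bsub>K\<^esub> y)" by simp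
      have xy: "x \<in> carrier K" "y \<in> carrier K" using x y CK by auto
      let ?u = "d \<otimes> inv (k c)"
      have u: "?u \<in> carrier G" by simp
      have "g = k x \<otimes> inv (k y)"
        using xy by (simp add: gxy)
      also have "\<dots> = (?u \<otimes> k x) \<otimes> inv (?u \<otimes> k y)"
        using xy u by (simp only: mult_div_mult k.hom_closed) (simp add: r_inv [OF u])
      finally have "g = (?u \<otimes> k x) \<otimes> inv (?u \<otimes> k y)" .
      moreover have "?u \<otimes> k x \<in> D \<union> E" "?u \<otimes> k y \<in> D \<union> E"
        using x y unfolding E_def by blast+
      ultimately show ?thesis by blast
    next
      assume "\<exists>x\<in>T. \<exists>y\<in>T. g \<otimes> inv x \<otimes> y \<in> h ` carrier H"
      then obtain s t a where s: "s \<in> T" and t: "t \<in> T" and "a \<in> carrier H"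
        and ga: "g \<otimes> inv s \<otimes> t = h a" by blast
      moreover from B(1) \<open>a \<in> carrier H\<close> obtain x y
        where x: "x \<in> B" and y: "y \<in> B" and "a = x \<otimes>\<^bsub>H\<^esub> inv\<^bsub>H\<^esub> y"
        unfolding difference_basis_def by auto
      ultimately have gxy: "g \<otimes> inv s \<otimes> t = h (x \<otimes>\<^bsub>H\<^esub> inv\<^bsub>H\<^esub> y)" by simp
      have xy: "x \<in> carrier H" "y \<in> carrier H" using x y BH by auto
      have st: "s \<in> carrier G" "t \<in> carrier G" using s t T by auto
      \<comment> \<open>The first factor is a difference of elements of the image of
        \<open>B\<close>, the second one of elements of \<open>T\<close>; commutativity regroups
        them into a difference of elements of \<open>D\<close>.\<close>
      have "g = (g \<otimes> inv s \<otimes> t) \<otimes> (s \<otimes> inv t)"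
      proof -
        have "(g \<otimes> inv s \<otimes> t) \<otimes> (s \<otimes> inv t) = g \<otimes> ((s \<otimes> inv s) \<otimes> (t \<otimes> inv t))"
          using g st by (simp only: m_ac inv_closed m_closed)
        then show ?thesis using g st by (simp add: r_inv)
      qed
      also have "\<dots> = (h x \<otimes> inv (h y)) \<otimes> (s \<otimes> inv t)"
        using xy by (simp add: gxy)
      also have "\<dots> = (s \<otimes> h x) \<otimes> inv (t \<otimes> h y)"
        using xy st by (simp add: mult_div_mult m_comm)
      finally have "g = (s \<otimes> h x) \<otimes> inv (t \<otimes> h y)" .
      moreover have "s \<otimes> h x \<in> D \<union> E" "t \<otimes> h y \<in> D \<union> E"
        using x y s t unfolding D_def by force+
      ultimately show ?thesis by blast
    qed
  qed
  then have "group_difference_size G \<le> card (D \<union> E)"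
    using D E by (intro difference_size_le) auto
  ultimately show ?thesis by simp
qed

section \<open>Scaled subgroups of a product of cyclic groups\<close>

lemma comm_group_product_group:
  assumes "\<And>i. i \<in> I \<Longrightarrow> comm_group (G i)"
  shows "comm_group (product_group I G)"
proof (rule group.group_comm_groupI)
  show "group (product_group I G)"
    using assms by (simp add: comm_group.axioms)
  show "x \<otimes>\<^bsub>product_group I G\<^esub> y = y \<otimes>\<^bsub>product_group I G\<^esub> x"
    if "x \<in> carrier (product_group I G)" "y \<in> carrier (product_group I G)" for x y
  proof -
    have "x i \<otimes>\<^bsub>G i\<^esub> y i = y i \<otimes>\<^bsub>G i\<^esub> x i" if i: "i \<in> I" for i
    proof -
      interpret comm_group "G i" using assms i by blast
      show ?thesis
        using that \<open>x \<in> _\<close> \<open>y \<in> _\<close> by (intro m_comm) (auto dest: PiE_mem)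
    qed
    then show ?thesis by (simp add: restrict_def fun_eq_iff)
  qed
qed

text \<open>Used with \<open>s = 2 * r\<close>, \<open>a = p ^ k\<close> and with
  \<open>s = r\<close>, \<open>a = p\<close>, to map the two smaller products onto the subgroups
  \<open>H\<close> and \<open>K\<close> of the big group. No reduction modulo
  \<open>p ^ ks i\<close> is taken, since the scaled representatives stay in range.\<close>

definition scaling_map :: "nat \<Rightarrow> nat \<Rightarrow> nat \<Rightarrow> (nat \<Rightarrow> int) \<times> (nat \<Rightarrow> int) \<Rightarrow> nat \<Rightarrow> int" where
  "scaling_map m s a = (\<lambda>(u, v). \<lambda>i\<in>{1..m}. if i \<le> s then int a * u i else v i)"

lemma carrier_integer_mod_group_power:
  assumes "0 < p"
  shows "carrier (integer_mod_group (p ^ n)) = {0..<int p ^ n}"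
  using assms by (simp add: carrier_integer_mod_group)

lemma power_split:
  assumes "j \<le> (n::nat)"
  shows "(x :: 'a :: monoid_mult) ^ n = x ^ j * x ^ (n - j)"
  using assms by (simp flip: power_add)

lemma scaling_map_hom:
  assumes p: "0 < p" and s: "s \<le> m" and j: "\<forall>i\<in>{1..s}. j \<le> ks i"
  shows "scaling_map m s (p ^ j) \<in>
    hom (product_group {1..s} (\<lambda>i. integer_mod_group (p ^ (ks i - j)))
         \<times>\<times> product_group {s+1..m} (\<lambda>i. integer_mod_group (p ^ ks i)))
        (product_group {1..m} (\<lambda>i. integer_mod_group (p ^ ks i)))"
    (is "_ \<in> hom ?H ?G")
proof (rule homI)
  note carrier = carrier_integer_mod_group_power [OF p]
  have split: "int p ^ ks i = int p ^ j * int p ^ (ks i - j)" if "i \<in> {1..s}" for i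
    using that j by (intro power_split) blast
  fix x assume x: "x \<in> carrier ?H"
  obtain u v where uv: "x = (u, v)" by fastforce
  have u: "u i \<in> {0..<int p ^ (ks i - j)}" if "i \<in> {1..s}" for i
    using x that by (auto simp: uv carrier dest: PiE_mem)
  have v: "v i \<in> {0..<int p ^ ks i}" if "i \<in> {s+1..m}" for i
    using x that by (auto simp: uv carrier dest: PiE_mem)
  show "scaling_map m s (p ^ j) x \<in> carrier ?G"
    unfolding carrier_product_group carrier uv scaling_map_def case_prod_conv restrict_PiE_iff
  proof
    fix i assume i: "i \<in> {1..m}"
    show "(if i \<le> s then int (p ^ j) * u i else v i) \<in> {0..<int p ^ ks i}"
    proof (cases "i \<le> s")
      case True
      with i have "i \<in> {1..s}" by simp
      from u [OF this] split [OF this] True show ?thesis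
        using p by (simp add: mult_strict_left_mono)
    next
      case False
      with i v [of i] show ?thesis by simp
    qed
  qed
  fix y assume y: "y \<in> carrier ?H"
  obtain u' v' where uv': "y = (u', v')" by fastforce
  \<comment> \<open>This rests on \<open>p ^ j * (z mod p ^ (n - j)) = (p ^ j * z) mod p ^ n\<close>
    for \<open>j \<le> n\<close>.\<close>
  have pointwise: "(if i \<le> s then int (p ^ j) * ((u i + u' i) mod int (p ^ (ks i - j)))
      else (v i + v' i) mod int (p ^ ks i))
    = ((if i \<le> s then int (p ^ j) * u i else v i) + (if i \<le> s then int (p ^ j) * u' i else v' i))
      mod int (p ^ ks i)" if "i \<in> {1..m}" for i
    using split [of i] that by (simp add: mult_mod_right distrib_left)
  show "scaling_map m s (p ^ j) (x \<otimes>\<^bsub>?H\<^esub> y)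
      = scaling_map m s (p ^ j) x \<otimes>\<^bsub>?G\<^esub> scaling_map m s (p ^ j) y"
  proof
    fix i
    show "scaling_map m s (p ^ j) (x \<otimes>\<^bsub>?H\<^esub> y) i
      = (scaling_map m s (p ^ j) x \<otimes>\<^bsub>?G\<^esub> scaling_map m s (p ^ j) y) i"
    proof (cases "i \<in> {1..m}")
      case True
      with pointwise [OF True] show ?thesis
        by (auto simp: uv uv' scaling_map_def split: if_splits)
    qed (auto simp: uv uv' scaling_map_def)
  qed
qed

lemma scaling_map_image:
  assumes p: "0 < p" and s: "s \<le> m" and j: "\<forall>i\<in>{1..s}. j \<le> ks i"
    and g: "g \<in> carrier (product_group {1..m} (\<lambda>i. integer_mod_group (p ^ ks i)))"
    and dvd: "\<And>i. i \<in> {1..s} \<Longrightarrow> int p ^ j dvd g i"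
  shows "g \<in> scaling_map m s (p ^ j) `
    carrier (product_group {1..s} (\<lambda>i. integer_mod_group (p ^ (ks i - j)))
         \<times>\<times> product_group {s+1..m} (\<lambda>i. integer_mod_group (p ^ ks i)))"
proof (rule image_eqI)
  note carrier = carrier_integer_mod_group_power [OF p]
  have gi: "g i \<in> {0..<int p ^ ks i}" if "i \<in> {1..m}" for i
    using g that by (auto simp: carrier dest: PiE_mem)
  define u where "u = (\<lambda>i\<in>{1..s}. g i div int p ^ j)"
  define v where "v = (\<lambda>i\<in>{s+1..m}. g i)"
  show "g = scaling_map m s (p ^ j) (u, v)"
  proof
    fix i
    show "g i = scaling_map m s (p ^ j) (u, v) i"
    proof (cases "i \<in> {1..m}")
      case True
      then show ?thesis using dvd [of i] by (auto simp: scaling_map_def u_def v_def)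
    next
      case False
      \<comment> \<open>Elements of the product are extensional: outside \<open>{1..m}\<close> both
        sides are \<open>undefined\<close>.\<close>
      with g have "g i = undefined"
        unfolding carrier_product_group by (intro PiE_arb)
      with False show ?thesis by (auto simp: scaling_map_def)
    qed
  qed
  have "u i \<in> {0..<int p ^ (ks i - j)}" if i: "i \<in> {1..s}" for i
  proof -
    have "int p ^ ks i = int p ^ j * int p ^ (ks i - j)"
      using i j by (intro power_split) blast
    moreover have "g i = int p ^ j * u i"
      using dvd [OF i] i by (simp add: u_def)
    moreover have "g i \<in> {0..<int p ^ ks i}" using i s by (intro gi) auto
    moreover have "0 < int p ^ j" using p by simp
    ultimately show ?thesis
      using mult_le_cancel_left_pos [of "int p ^ j" 0 "u i"] by simp
  qed
  then have "u \<in> (\<Pi>\<^sub>E i\<in>{1..s}. {0..<int p ^ (ks i - j)})"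
    by (auto simp: u_def)
  moreover have "v \<in> (\<Pi>\<^sub>E i\<in>{s+1..m}. {0..<int p ^ ks i})"
    using gi by (auto simp: v_def)
  ultimately show "(u, v) \<in> carrier (product_group {1..s} (\<lambda>i. integer_mod_group (p ^ (ks i - j)))
         \<times>\<times> product_group {s+1..m} (\<lambda>i. integer_mod_group (p ^ ks i)))"
    by (simp add: carrier)
qed

lemma card_product_integer_mod_group:
  assumes "0 < (p::nat)" "finite I"
  shows "card (carrier (product_group I (\<lambda>i. integer_mod_group (p ^ e i)))) = (\<Prod>i\<in>I. p ^ e i)"
    and "finite (carrier (product_group I (\<lambda>i. integer_mod_group (p ^ e i))))"
  using assms
  by (simp_all add: carrier_integer_mod_group_power card_PiE finite_PiE nat_power_eq)

text \<open>Each of the first \<open>s\<close> factors shrinks by \<open>p ^ j\<close>. The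
  resulting index converts between the square roots in the second inequality.\<close>

lemma card_scaled_product:
  assumes p: "0 < (p::nat)" and s: "s \<le> m" and j: "\<forall>i\<in>{1..s}. j \<le> ks i"
  shows "card (carrier (product_group {1..m} (\<lambda>i. integer_mod_group (p ^ ks i)))) =
    p ^ (j * s) * card (carrier (product_group {1..s} (\<lambda>i. integer_mod_group (p ^ (ks i - j)))
         \<times>\<times> product_group {s+1..m} (\<lambda>i. integer_mod_group (p ^ ks i))))"
proof -
  have "(\<Prod>i\<in>{1..m}. p ^ ks i) = (\<Prod>i\<in>{1..s}. p ^ ks i) * (\<Prod>i\<in>{s+1..m}. p ^ ks i)"
    using prod.ub_add_nat [of 1 s "\<lambda>i. p ^ ks i" "m - s"] s by simp
  also have "(\<Prod>i\<in>{1..s}. p ^ ks i) = (\<Prod>i\<in>{1..s}. p ^ j * p ^ (ks i - j))"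
    using j by (intro prod.cong refl power_split) blast
  also have "\<dots> = p ^ (j * s) * (\<Prod>i\<in>{1..s}. p ^ (ks i - j))"
    by (simp add: prod.distrib power_mult)
  finally show ?thesis
    using p by (simp add: card_product_integer_mod_group card_cartesian_product
        del: carrier_product_group)
qed

section \<open>The covering by the lifted parabola and the two inequalities\<close>

text \<open>The coordinates of the product group are numbered from 1, those of \<open>c\<close> and \<open>f c\<close> from 0.\<close>

definition parabola_point ::
  "nat \<Rightarrow> nat \<Rightarrow> (nat \<Rightarrow> nat) \<Rightarrow> ((nat \<Rightarrow> int) \<Rightarrow> nat \<Rightarrow> int) \<Rightarrow> (nat \<Rightarrow> int) \<Rightarrow> nat \<Rightarrow> int"
  where "parabola_point m r q f c = (\<lambda>i\<in>{1..m}.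
    (if i \<le> r then c (i - 1) else if i \<le> 2 * r then f c (i - 1 - r) else 0) mod int (q i))"

text \<open>The covering inequality is applied with two scaling maps and with at most
  \<open>p ^ (k * r)\<close> parabola points as \<open>T\<close>. The bounds on \<open>ks\<close>
  keep the natural subtractions \<open>ks i - k\<close> and \<open>ks i - 1\<close> exact.\<close>

lemma Suc_difference_size_product_le:
  fixes p m k r :: nat and ks :: "nat \<Rightarrow> nat"
  assumes p: "prime p" and odd: "odd p" and m: "2 * r \<le> m"
    and k: "\<forall>i\<in>{1..2*r}. k \<le> ks i" and one: "\<forall>i\<in>{1..r}. 1 \<le> ks i"
  shows "Suc (group_difference_size (product_group {1..m} (\<lambda>i. integer_mod_group (p ^ ks i))))
     \<le> group_difference_size
          (product_group {1..2*r} (\<lambda>i. integer_mod_group (p ^ (ks i - k)))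
           \<times>\<times> product_group {2*r+1..m} (\<lambda>i. integer_mod_group (p ^ ks i))) * p ^ (k * r)
       + group_difference_size
          (product_group {1..r} (\<lambda>i. integer_mod_group (p ^ (ks i - 1)))
           \<times>\<times> product_group {r+1..m} (\<lambda>i. integer_mod_group (p ^ ks i)))"
    (is "Suc (group_difference_size ?G)
      \<le> group_difference_size ?H * _ + group_difference_size ?K")
proof -
  have p0: "0 < p" using p by (rule prime_gt_0_nat)
  note carrier = carrier_integer_mod_group_power [OF p0]
  have r: "r \<le> m" using m by simp
  obtain f :: "(nat \<Rightarrow> int) \<Rightarrow> nat \<Rightarrow> int"
    where f: "\<forall>n x y. (\<forall>i<r. [x i = y i] (mod n)) \<longrightarrow> (\<forall>l<r. [f x l = f y l] (mod n))"
      "\<forall>k d e. \<not> (\<forall>i<r. int p dvd d i) \<longrightarrow>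
        (\<exists>x. \<forall>l<r. [f (\<lambda>i. x i + d i) l - f x l = e l] (mod int p ^ k))"
    using exists_planar_function [OF p odd, of r] by (elim exE conjE) (rule that)
  have f_cong: "[f x l = f y l] (mod n)" if "\<forall>i<r. [x i = y i] (mod n)" "l < r" for n x y l
    using f(1) that by blast
  have planar: "\<exists>x. \<forall>l<r. [f (\<lambda>i. x i + d i) l - f x l = e l] (mod int p ^ k)"
    if "\<not> (\<forall>i<r. int p dvd d i)" for k d e
    using f(2) that by (elim allE impE) assumption+
  define N where "N = int p ^ k"
  have N: "0 < N" using p0 by (simp add: N_def)
  \<comment> \<open>Parameters run through residues modulo \<open>p ^ k\<close> only, although
    coordinates live modulo \<open>p ^ ks i\<close>: the image of \<open>?H\<close> absorbs
    multiples of \<open>p ^ k\<close>.\<close>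
  let ?D = "{..<r} \<rightarrow>\<^sub>E {0..<N}"
  define P where "P = parabola_point m r (\<lambda>i. p ^ ks i) f"
  have "finite ?D" by (simp add: finite_PiE)
  have "card (P ` ?D) \<le> card ?D"
    using \<open>finite ?D\<close> by (rule card_image_le)
  also have "\<dots> = p ^ (k * r)"
    by (simp add: card_PiE N_def nat_power_eq power_mult)
  finally have card: "card (P ` ?D) \<le> p ^ (k * r)" .
  have P_closed: "P c \<in> carrier ?G" for c
    using p0 by (simp add: P_def parabola_point_def restrict_PiE_iff carrier)
  interpret G: comm_group ?G by (rule comm_group_product_group) simp
  have "Suc (group_difference_size ?G)
    \<le> group_difference_size ?H * card (P ` ?D) + group_difference_size ?K"
  proof (rule G.Suc_difference_size_le)
    show "group ?H" "group ?K" by (simp_all add: DirProd_group)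
    show "finite (carrier ?H)" "finite (carrier ?K)"
      unfolding carrier_DirProd
      by (intro finite_cartesian_product card_product_integer_mod_group(2) p0 finite_atLeastAtMost)+
    show "scaling_map m (2 * r) (p ^ k) \<in> hom ?H ?G"
      by (rule scaling_map_hom [OF p0 m k])
    show "scaling_map m r (p ^ 1) \<in> hom ?K ?G"
      by (rule scaling_map_hom [OF p0 r one])
    show "P ` ?D \<subseteq> carrier ?G" using P_closed by (rule image_subsetI)
    show "finite (P ` ?D)" using \<open>finite ?D\<close> by (rule finite_imageI)
    show "P ` ?D \<noteq> {}" using N by (simp add: PiE_eq_empty_iff)
    fix g assume g: "g \<in> carrier ?G"
    show "g \<in> scaling_map m r (p ^ 1) ` carrier ?K \<or>
      (\<exists>x\<in>P ` ?D. \<exists>y\<in>P ` ?D. g \<otimes>\<^bsub>?G\<^esub> inv\<^bsub>?G\<^esub> x \<otimes>\<^bsub>?G\<^esub> y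
         \<in> scaling_map m (2 * r) (p ^ k) ` carrier ?H)"
    proof (cases "\<forall>i<r. int p dvd g (i + 1)")
      case True
      have "int p ^ 1 dvd g i" if i: "i \<in> {1..r}" for i
      proof -
        have "i - 1 < r" "i - 1 + 1 = i" using i by auto
        then show ?thesis using True by (metis power_one_right)
      qed
      then show ?thesis using scaling_map_image [OF p0 r one g] by blast
    next
      case False
      \<comment> \<open>The direction consists of the first \<open>r\<close> coordinates of
        \<open>g\<close>, the prescribed increment of \<open>f\<close> of the next \<open>r\<close>
        ones.\<close>
      then obtain x where x: "\<And>l. l < r \<Longrightarrow>
          [f (\<lambda>i. x i + g (i + 1)) l - f x l = g (l + 1 + r)] (mod N)"
        using planar [of "\<lambda>i. g (i + 1)" "\<lambda>i. g (i + 1 + r)" k] unfolding N_def by blast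
      \<comment> \<open>The parameters \<open>x + d\<close> and \<open>x\<close>, with
        \<open>d\<close> the direction, are reduced into \<open>?D\<close>; by \<open>f_cong\<close>
        the increment of \<open>f\<close> survives modulo \<open>N\<close>.\<close>
      define c where "c = (\<lambda>i\<in>{..<r}. (x i + g (i + 1)) mod N)"
      define c' where "c' = (\<lambda>i\<in>{..<r}. x i mod N)"
      have D: "c \<in> ?D" "c' \<in> ?D"
        by (simp_all add: c_def c'_def restrict_PiE_iff N)
      have c: "[c i = x i + g (i + 1)] (mod N)" and c': "[c' i = x i] (mod N)" if "i < r" for i
        using that by (simp_all add: c_def c'_def)
      have fc: "[f c l - f c' l = g (l + 1 + r)] (mod N)" if "l < r" for l
      proof -
        have "[f c l - f c' l = f (\<lambda>i. x i + g (i + 1)) l - f x l] (mod N)"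
          using that c c' by (intro cong_diff f_cong) auto
        then show ?thesis using x [OF that] by (rule cong_trans)
      qed
      let ?w = "g \<otimes>\<^bsub>?G\<^esub> inv\<^bsub>?G\<^esub> P c \<otimes>\<^bsub>?G\<^esub> P c'"
      have w: "?w \<in> carrier ?G"
        by (intro G.m_closed G.inv_closed g P_closed)
      have "int p ^ k dvd ?w i" if i: "i \<in> {1..2 * r}" for i
      proof -
        have im: "i \<in> {1..m}" using i m by simp
        \<comment> \<open>As \<open>N\<close> divides the modulus \<open>p ^ ks i\<close>,
          reductions in the group are invisible modulo \<open>N\<close>.\<close>
        have N_dvd: "N dvd int p ^ ks i"
          unfolding N_def using k i by (intro le_imp_power_dvd) blast
        have modN: "[a mod int (p ^ ks i) = a] (mod N)" for a
          using N_dvd by (simp add: cong_def mod_mod_cancel)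
        have Pi: "P c i \<in> carrier (integer_mod_group (p ^ ks i))" for c
          using P_closed [of c] im by (auto dest: PiE_mem)
        have inv_i: "(inv\<^bsub>?G\<^esub> P c) i = (- P c i) mod int (p ^ ks i)"
          using P_closed [of c] im Pi [of c] by (subst inv_product_group) simp_all
        have "?w i = ((g i + (inv\<^bsub>?G\<^esub> P c) i) mod int (p ^ ks i) + P c' i) mod int (p ^ ks i)"
          using im by simp
        also have "[\<dots> = g i + - P c i + P c' i] (mod N)"
          unfolding inv_i
          by (intro cong_trans [OF modN] cong_add cong_refl modN)
        finally have w_cong: "[?w i = g i + - P c i + P c' i] (mod N)" .
        \<comment> \<open>For \<open>i \<le> r\<close> this is the choice of the two parameters, for
          larger \<open>i\<close> it is the planarity of \<open>f\<close>.\<close>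
        have "[P c i - P c' i = g i] (mod N)"
        proof (cases "i \<le> r")
          case True
          have "[P c i - P c' i = c (i - 1) - c' (i - 1)] (mod N)"
            unfolding P_def parabola_point_def using im True
            by (simp del: of_nat_power) (intro cong_diff modN)
          also have "[c (i - 1) - c' (i - 1) = (x (i - 1) + g (i - 1 + 1)) - x (i - 1)] (mod N)"
            using True i by (intro cong_diff c c') auto
          also have "(x (i - 1) + g (i - 1 + 1)) - x (i - 1) = g i" using i by simp
          finally show ?thesis .
        next
          case False
          have "[P c i - P c' i = f c (i - 1 - r) - f c' (i - 1 - r)] (mod N)"
            unfolding P_def parabola_point_def using im i False
            by (simp del: of_nat_power) (intro cong_diff modN)
          also have "[f c (i - 1 - r) - f c' (i - 1 - r) = g (i - 1 - r + 1 + r)] (mod N)"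
            using False i by (intro fc) auto
          also have "i - 1 - r + 1 + r = i" using False i by simp
          finally show ?thesis .
        qed
        then have "[g i - (P c i - P c' i) = g i - g i] (mod N)"
          by (intro cong_diff cong_refl)
        then have "[g i + - P c i + P c' i = 0] (mod N)" by (simp add: algebra_simps)
        with w_cong have "[?w i = 0] (mod N)" by (rule cong_trans)
        then show ?thesis by (simp add: N_def cong_0_iff)
      qed
      then have "?w \<in> scaling_map m (2 * r) (p ^ k) ` carrier ?H"
        by (rule scaling_map_image [OF p0 m k w])
      then show ?thesis using D by blast
    qed
  qed
  also have "\<dots> \<le> group_difference_size ?H * p ^ (k * r) + group_difference_size ?K"
    using card by simp
  finally show ?thesis .
qed

theorem theorem6p2:
  fixes p m k r :: nat and ks :: "nat \<Rightarrow> nat"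
  assumes "prime p" and "odd p"
    and "2 * r \<le> m"
    and "\<forall>i\<in>{1..2*r}. k \<le> ks i"
    and "\<forall>i\<in>{1..r}. 1 \<le> ks i"
  shows
    "int (group_difference_size (product_group {1..m} (\<lambda>i. integer_mod_group (p ^ ks i))))
       \<le> int (group_difference_size
               (product_group {1..2*r} (\<lambda>i. integer_mod_group (p ^ (ks i - k)))
                \<times>\<times> product_group {2*r+1..m} (\<lambda>i. integer_mod_group (p ^ ks i))))
           * int p ^ (k * r)
         + int (group_difference_size
               (product_group {1..r} (\<lambda>i. integer_mod_group (p ^ (ks i - 1)))
                \<times>\<times> product_group {r+1..m} (\<lambda>i. integer_mod_group (p ^ ks i))))
         - 1
     \<and>
     group_difference_characteristic (product_group {1..m} (\<lambda>i. integer_mod_group (p ^ ks i)))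
       \<le> group_difference_characteristic
               (product_group {1..2*r} (\<lambda>i. integer_mod_group (p ^ (ks i - k)))
                \<times>\<times> product_group {2*r+1..m} (\<lambda>i. integer_mod_group (p ^ ks i)))
         + 1 / sqrt (real (p ^ r))
           * group_difference_characteristic
               (product_group {1..r} (\<lambda>i. integer_mod_group (p ^ (ks i - 1)))
                \<times>\<times> product_group {r+1..m} (\<lambda>i. integer_mod_group (p ^ ks i)))
         - (\<Prod>i=1..m. 1 / sqrt (real (p ^ ks i)))"
    (is "int (group_difference_size ?G)
        \<le> int (group_difference_size ?H) * _ + int (group_difference_size ?K) - 1 \<and> _")
proof
  have p: "0 < p" using \<open>prime p\<close> by (rule prime_gt_0_nat)
  have r: "r \<le> m" using \<open>2 * r \<le> m\<close> by simp
  have le: "Suc (group_difference_size ?G)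
      \<le> group_difference_size ?H * p ^ (k * r) + group_difference_size ?K"
    by (rule Suc_difference_size_product_le [OF assms])
  then have "int (Suc (group_difference_size ?G))
      \<le> int (group_difference_size ?H * p ^ (k * r) + group_difference_size ?K)"
    by (simp only: of_nat_le_iff)
  then show "int (group_difference_size ?G)
      \<le> int (group_difference_size ?H) * int p ^ (k * r) + int (group_difference_size ?K) - 1"
    by simp
  \<comment> \<open>The second inequality is the first one divided by \<open>S\<close>; it remains
    to identify the quotients.\<close>
  define S where "S = sqrt (real (card (carrier ?G)))"
  have card_G: "card (carrier ?G) = (\<Prod>i=1..m. p ^ ks i)"
    by (rule card_product_integer_mod_group(1) [OF p]) simp
  have S_pos: "0 < S" unfolding S_def card_G using p by (simp add: prod_pos)
  \<comment> \<open>The summand \<open>- 1\<close> of the first inequality becomes this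
    product.\<close>
  have S_prod: "(\<Prod>i=1..m. 1 / sqrt (real (p ^ ks i))) = 1 / S"
  proof -
    have "sqrt (\<Prod>i\<in>I. a i) = (\<Prod>i\<in>I. sqrt (a i))" for I and a :: "nat \<Rightarrow> real"
      by (induction I rule: infinite_finite_induct) (simp_all add: real_sqrt_mult)
    then show ?thesis
      unfolding S_def card_G of_nat_prod by (simp only: prod_dividef prod.neutral_const)
  qed
  \<comment> \<open>The index of \<open>H\<close> is the square of \<open>p ^ (k * r)\<close>, so
    this factor cancels on division by \<open>S\<close> and the characteristic of \<open>?H\<close>
    remains.\<close>
  have "card (carrier ?G) = p ^ (k * (2 * r)) * card (carrier ?H)"
    by (rule card_scaled_product [OF p assms(3,4)])
  also have "p ^ (k * (2 * r)) = (p ^ (k * r))\<^sup>2"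
    by (simp add: ac_simps flip: power_mult)
  finally have S_H: "S = real p ^ (k * r) * sqrt (real (card (carrier ?H)))"
    unfolding S_def by (simp add: real_sqrt_mult del: carrier_product_group)
  \<comment> \<open>The index \<open>p ^ r\<close> of \<open>K\<close> is the source of the
    coefficient \<open>1 / sqrt (real (p ^ r))\<close>.\<close>
  have "card (carrier ?G) = p ^ (1 * r) * card (carrier ?K)"
    by (rule card_scaled_product [OF p r assms(5)])
  then have S_K: "S = sqrt (real (p ^ r)) * sqrt (real (card (carrier ?K)))"
    unfolding S_def by (simp add: real_sqrt_mult del: carrier_product_group)
  have "real (Suc (group_difference_size ?G))
      \<le> real (group_difference_size ?H * p ^ (k * r) + group_difference_size ?K)"
    using le by (simp only: of_nat_le_iff)
  then have "real (group_difference_size ?G)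
      \<le> real (group_difference_size ?H) * real p ^ (k * r) + real (group_difference_size ?K) - 1"
    by simp
  then have "real (group_difference_size ?G) / S
      \<le> (real (group_difference_size ?H) * real p ^ (k * r) + real (group_difference_size ?K) - 1) / S"
    using S_pos by (intro divide_right_mono) simp_all
  also have "\<dots> = real (group_difference_size ?H) * real p ^ (k * r) / S
      + real (group_difference_size ?K) / S - 1 / S"
    by (simp add: add_divide_distrib diff_divide_distrib)
  also have "real (group_difference_size ?H) * real p ^ (k * r) / S
      = group_difference_characteristic ?H"
    unfolding S_H difference_characteristic_def using p by (simp del: carrier_product_group)
  also have "real (group_difference_size ?K) / S
      = 1 / sqrt (real (p ^ r)) * group_difference_characteristic ?K"
    unfolding S_K difference_characteristic_def by (simp del: carrier_product_group)
  finally show "group_difference_characteristic ?G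
      \<le> group_difference_characteristic ?H
        + 1 / sqrt (real (p ^ r)) * group_difference_characteristic ?K
        - (\<Prod>i=1..m. 1 / sqrt (real (p ^ ks i)))"
    unfolding S_prod by (simp only: difference_characteristic_def [of ?G] S_def)
qed

end
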